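(* Let $q>kn^k$ and $(r+\delta-1)\mid n$. Then there exists an optimal $[n,k,d_{\min}]$ code over $\mathbb{F}_q$ with $(r,\delta)$ all-symbol locality, i.e. a code with $(r,\delta)$ all-symbol locality for which $$d_{\min}=n-k+1-\left(\left\lceil \frac{k}{r}\right\rceil-1\right)(\delta-1).$$
   Context: An $[n,k,d_{\min}]$ code over the finite field $\mathbb{F}_q$ is a linear code of length $n$, dimension $k$ and minimum distance $d_{\min}$. For such a code $\mathcal{C}$ with generator matrix $G$ and for $S\subseteq[n]=\{1,\dots,n\}$, $\mathcal{C}|_S$ denotes the code obtained by puncturing $\mathcal{C}$ to the coordinates in $S$, and $G|_S$ denotes the submatrix of $G$ formed by the columns indexed by $S$. Locality parameters $(r,\delta)$ are taken with $\delta\ge2$. The code $\mathcal{C}$ has $(r,\delta)$ information locality if there is a family of sets $\{S_i\}_{i\in\mathcal{L}}$, $S_i\subseteq[n]$, such that $|S_i|\le r+\delta-1$ and $d_{\min}(\mathcal{C}|_{S_i})\ge\delta$ for all $i\in\mathcal{L}$, and $\mathrm{Rank}(G|_{\cup_{i\in\mathcal{L}}S_i})=k$. If moreover $\cup_{i\in\mathcal{L}}S_i=[n]$, the code has $(r,\delta)$ all-symbol locality. Every $[n,k,d_{\min}]$ code with $(r,\delta)$ information locality satisfies $d_{\min}\le n-k+1-(\lceil k/r\rceil-1)(\delta-1)$; a code with all-symbol locality is called optimal if it attains this bound with equality.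
   Formalization: Assumes k ≥ 1, r ≥ 1 and that the prescribed value n−k+1−(⌈k/r⌉−1)(δ−1) of d_min is at least 1; otherwise no such code exists (e.g. r=1, δ=2, n=k=2, q=9 prescribes d_min=0). *)

theory Defs
  imports
    Complex_Main
    "HOL-Library.Cardinality"
    "Jordan_Normal_Form.DL_Rank"
    "Jordan_Normal_Form.DL_Submatrix"
begin

text \<open>Coordinates are indexed from 0, so the index set \<open>[n]\<close> is \<open>{..<n}\<close>.\<close>

definition hamming_distance :: "'a vec \<Rightarrow> 'a vec \<Rightarrow> nat" where
  "hamming_distance x y = card {i. i < dim_vec x \<and> x $ i \<noteq> y $ i}"

text \<open>The minimum distance of a code with at most one codeword is not defined in the literature.
  Here it is 0, so that such a code never satisfies \<open>min_distance C \<ge> \<delta>\<close> for a positive \<open>\<delta>\<close>.\<close>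

definition min_distance :: "'a vec set \<Rightarrow> nat" where
  "min_distance C =
     (let D = {hamming_distance x y | x y. x \<in> C \<and> y \<in> C \<and> x \<noteq> y}
      in if D = {} then 0 else Inf D)"

definition linear_code :: "nat \<Rightarrow> nat \<Rightarrow> nat \<Rightarrow> 'a::field vec set \<Rightarrow> bool" where
  "linear_code n k d C \<longleftrightarrow>
     VectorSpace.subspace class_ring C (module_vec TYPE('a) n) \<and>
     vectorspace.dim class_ring (module_vec TYPE('a) n\<lparr>carrier := C\<rparr>) = k \<and>
     min_distance C = d"

definition generator_matrix :: "nat \<Rightarrow> nat \<Rightarrow> 'a::field vec set \<Rightarrow> 'a mat \<Rightarrow> bool" where
  "generator_matrix n k C G \<longleftrightarrow>
     G \<in> carrier_mat k n \<and> vec_space.row_space n G = C \<and> vec_space.rank k G = k"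

text \<open>\<open>puncture S C\<close> keeps the coordinates in \<open>S\<close> and deletes the others; like \<open>submatrix\<close>, it
  lists the remaining coordinates in increasing order.\<close>

definition puncture :: "nat set \<Rightarrow> 'a vec set \<Rightarrow> 'a vec set" where
  "puncture S C = (\<lambda>c. vec (card {i. i < dim_vec c \<and> i \<in> S}) (\<lambda>j. c $ pick S j)) ` C"

definition locality_family ::
    "nat \<Rightarrow> nat \<Rightarrow> nat \<Rightarrow> nat \<Rightarrow> 'a::field vec set \<Rightarrow> nat set set \<Rightarrow> bool" where
  "locality_family n k r \<delta> C \<S> \<longleftrightarrow>
     (\<forall>S\<in>\<S>. S \<subseteq> {..<n} \<and> card S \<le> r + \<delta> - 1 \<and> min_distance (puncture S C) \<ge> \<delta>) \<and>
     (\<exists>G. generator_matrix n k C G \<and> vec_space.rank k (submatrix G UNIV (\<Union>\<S>)) = k)"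

definition information_locality :: "nat \<Rightarrow> nat \<Rightarrow> nat \<Rightarrow> nat \<Rightarrow> 'a::field vec set \<Rightarrow> bool" where
  "information_locality n k r \<delta> C \<longleftrightarrow> (\<exists>\<S>. locality_family n k r \<delta> C \<S>)"

definition all_symbol_locality :: "nat \<Rightarrow> nat \<Rightarrow> nat \<Rightarrow> nat \<Rightarrow> 'a::field vec set \<Rightarrow> bool" where
  "all_symbol_locality n k r \<delta> C \<longleftrightarrow> (\<exists>\<S>. locality_family n k r \<delta> C \<S> \<and> \<Union>\<S> = {..<n})"

definition distance_bound :: "nat \<Rightarrow> nat \<Rightarrow> nat \<Rightarrow> nat \<Rightarrow> int" where
  "distance_bound n k r \<delta> =
     int n - int k + 1 - (\<lceil>real k / real r\<rceil> - 1) * (int \<delta> - 1)"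

definition optimal_code :: "nat \<Rightarrow> nat \<Rightarrow> nat \<Rightarrow> nat \<Rightarrow> nat \<Rightarrow> 'a::field vec set \<Rightarrow> bool" where
  "optimal_code n k d r \<delta> C \<longleftrightarrow>
     linear_code n k d C \<and> all_symbol_locality n k r \<delta> C \<and> int d = distance_bound n k r \<delta>"

end

theory Submission
  imports Defs "Jordan_Normal_Form.DL_Rank_Submatrix"
begin

text \<open>
  Let \<open>s = r + \<delta> - 1\<close> and split the coordinates into blocks of length \<open>s\<close>. The columns of a generator
  matrix are chosen greedily: the first \<open>r\<close> columns of a block are arbitrary and the remaining
  \<open>\<delta> - 1\<close> lie in the span of these, but every set of at most \<open>k\<close> columns with at most \<open>r\<close> in each
  block is to be linearly independent. For each of the fewer than \<open>q\<close> relevant sets of earlier columns,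
  a new column only has to avoid a hyperplane that does not contain all permitted vectors, so a choice exists.
  A message \<open>x \<noteq> 0\<close> annihilates no such independent set of size \<open>k\<close>, and counting block by block
  shows that its codeword has fewer than \<open>k + (\<lceil>k/r\<rceil> - 1)(\<delta> - 1)\<close> zeros; within a block a nonzero
  restriction has fewer than \<open>r\<close> zeros. Spans and independence are handled dually, through
  annihilators and their cardinalities, which over a finite field replaces dimension theory.
\<close>

section \<open>Annihilators over a finite field\<close>

lemma one_less_card_field: "1 < CARD('a::{field,finite})"
  using card_mono[of "UNIV :: 'a set" "{0, 1}"] by simp

lemma card_carrier_vec: "card (carrier_vec k :: 'a::finite vec set) = CARD('a) ^ k"
proof -
  have "bij_betw vec_of_list {xs :: 'a list. set xs \<subseteq> UNIV \<and> length xs = k} (carrier_vec k)"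
    by (rule bij_betw_byWitness[where f' = list_of_vec]) (auto simp: list_vec vec_list intro: carrier_vecI)
  from bij_betw_same_card[OF this] show ?thesis
    using card_lists_length_eq[of "UNIV :: 'a set" k] by simp
qed

lemma finite_carrier_vec: "finite (carrier_vec k :: 'a::finite vec set)"
  by (rule card_ge_0_finite) (simp add: card_carrier_vec)

text \<open>The orthogonal complement, among the messages \<open>x\<close>, of the columns indexed
  by \<open>T\<close>. Over a field and for finite \<open>T\<close>, a vector \<open>v\<close> lies
  in the span of these columns exactly when every element of \<open>annih k g T\<close> is
  orthogonal to \<open>v\<close>; span conditions are stated in this form below.\<close>

definition annih :: "nat \<Rightarrow> (nat \<Rightarrow> 'a::semiring_0 vec) \<Rightarrow> nat set \<Rightarrow> 'a vec set" where
  "annih k g T = {x \<in> carrier_vec k. \<forall>j\<in>T. x \<bullet> g j = 0}"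

lemma finite_annih: "finite (annih k g T :: 'a::{semiring_0,finite} vec set)"
  by (rule finite_subset[OF _ finite_carrier_vec]) (auto simp: annih_def)

lemma annih_cong: "(\<And>j. j \<in> T \<Longrightarrow> g j = h j) \<Longrightarrow> annih k g T = annih k h T"
  by (auto simp: annih_def)

lemma annih_mono: "S \<subseteq> T \<Longrightarrow> annih k g T \<subseteq> annih k g S"
  by (auto simp: annih_def)

lemma zero_in_annih: "(\<And>j. g j \<in> carrier_vec k) \<Longrightarrow> 0\<^sub>v k \<in> annih k g T"
  by (simp add: annih_def)

text \<open>The functional \<open>x \<bullet> g j\<close> splits \<open>annih k g T\<close> into
  \<open>q\<close> fibres. Subtracting a fixed element embeds a nonempty fibre into the fibre over
  0, which is \<open>annih k g (insert j T)\<close>.\<close>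

lemma card_annih_le_insert:
  fixes g :: "nat \<Rightarrow> 'a::{field,finite} vec"
  assumes "g j \<in> carrier_vec k" "\<And>i. i \<in> T \<Longrightarrow> g i \<in> carrier_vec k"
  shows "card (annih k g T) \<le> CARD('a) * card (annih k g (insert j T))"
proof -
  let ?F = "\<lambda>a. {x \<in> annih k g T. x \<bullet> g j = a}"
  have "card (?F a) \<le> card (annih k g (insert j T))" for a
  proof (cases "?F a = {}")
    case False
    then obtain x0 where x0: "x0 \<in> ?F a" by blast
    show ?thesis
    proof (rule card_inj_on_le[where f = "\<lambda>x. x - x0"])
      show "inj_on (\<lambda>x. x - x0) (?F a)"
      proof (rule inj_onI)
        fix x y assume xy: "x \<in> ?F a" "y \<in> ?F a" "x - x0 = y - x0"
        have "x \<in> carrier_vec k" "y \<in> carrier_vec k" "x0 \<in> carrier_vec k"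
          using xy x0 by (auto simp: annih_def)
        then have "x = x - x0 + x0" "y = y - x0 + x0" by auto
        then show "x = y" using xy(3) by metis
      qed
      show "(\<lambda>x. x - x0) ` ?F a \<subseteq> annih k g (insert j T)"
        using x0 assms by (auto simp: annih_def minus_scalar_prod_distrib)
    qed (rule finite_annih)
  next
    case True
    show ?thesis unfolding True by simp
  qed
  then have "(\<Sum>a\<in>UNIV. card (?F a)) \<le> CARD('a) * card (annih k g (insert j T))"
    using sum_bounded_above[of UNIV "\<lambda>a. card (?F a)"] by simp
  moreover have "annih k g T = (\<Union>a\<in>UNIV. ?F a)" by auto
  then have "card (annih k g T) \<le> (\<Sum>a\<in>UNIV. card (?F a))"
    using card_UN_le[of "UNIV :: 'a set" ?F] by simp
  ultimately show ?thesis by linarith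
qed

text \<open>If \<open>x\<close> is not orthogonal to \<open>g j\<close>, then the pairs of a scalar
  \<open>a\<close> and a vector \<open>u\<close> orthogonal to \<open>g j\<close> embed via
  \<open>u + a x\<close>: the product with \<open>g j\<close> recovers \<open>a\<close>, and then
  \<open>u\<close>.\<close>

lemma card_annih_insert_le:
  fixes g :: "nat \<Rightarrow> 'a::{field,finite} vec"
  assumes "g j \<in> carrier_vec k" "\<And>i. i \<in> T \<Longrightarrow> g i \<in> carrier_vec k"
    and x: "x \<in> annih k g T" "x \<bullet> g j \<noteq> 0"
  shows "CARD('a) * card (annih k g (insert j T)) \<le> card (annih k g T)"
proof -
  let ?K = "annih k g (insert j T)"
  let ?f = "\<lambda>(a, u). u + a \<cdot>\<^sub>v x"
  have xc: "x \<in> carrier_vec k" using x by (simp add: annih_def)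
  have "inj_on ?f (UNIV \<times> ?K)"
  proof (rule inj_onI, clarify)
    fix a b u v assume uv: "u \<in> ?K" "v \<in> ?K" and eq: "u + a \<cdot>\<^sub>v x = v + b \<cdot>\<^sub>v x"
    have c: "u \<in> carrier_vec k" "v \<in> carrier_vec k" using uv by (auto simp: annih_def)
    have "(u + a \<cdot>\<^sub>v x) \<bullet> g j = a * (x \<bullet> g j)" "(v + b \<cdot>\<^sub>v x) \<bullet> g j = b * (x \<bullet> g j)"
      using uv xc assms(1) by (auto simp: annih_def add_scalar_prod_distrib)
    then have "a = b" using eq x(2) by simp
    moreover have "u = u + a \<cdot>\<^sub>v x - a \<cdot>\<^sub>v x" "v = v + a \<cdot>\<^sub>v x - a \<cdot>\<^sub>v x"
      using c xc by auto
    ultimately show "a = b \<and> u = v" using eq by metis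
  qed
  moreover have "?f ` (UNIV \<times> ?K) \<subseteq> annih k g T"
    using x assms(2) by (auto simp: annih_def add_scalar_prod_distrib)
  ultimately have "card (UNIV \<times> ?K :: ('a \<times> 'a vec) set) \<le> card (annih k g T)"
    by (rule card_inj_on_le) (rule finite_annih)
  then show ?thesis by (simp add: card_cartesian_product)
qed

lemma card_annih_ge:
  fixes g :: "nat \<Rightarrow> 'a::{field,finite} vec"
  assumes "finite T" "\<And>i. g i \<in> carrier_vec k"
  shows "CARD('a) ^ k \<le> CARD('a) ^ card T * card (annih k g T)"
  using assms(1)
proof (induction T)
  case empty
  then show ?case by (simp add: annih_def card_carrier_vec)
next
  case (insert j T)
  note insert.IH
  also have "CARD('a) ^ card T * card (annih k g T)
      \<le> CARD('a) ^ card T * (CARD('a) * card (annih k g (insert j T)))"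
    using card_annih_le_insert[of g j k T] assms(2) by (intro mult_le_mono2) auto
  also have "\<dots> = CARD('a) ^ card (insert j T) * card (annih k g (insert j T))"
    using insert.hyps by simp
  finally show ?case .
qed

text \<open>Fewer than \<open>k\<close> homogeneous equations in \<open>k\<close> unknowns: by
  \<open>card_annih_ge\<close> there are at least \<open>q\<close> solutions.\<close>

lemma exists_annih_nonzero:
  fixes g :: "nat \<Rightarrow> 'a::{field,finite} vec"
  assumes "finite T" "\<And>i. g i \<in> carrier_vec k" "card T < k"
  shows "\<exists>x \<in> annih k g T. x \<noteq> 0\<^sub>v k"
proof (rule ccontr)
  assume "\<not> ?thesis"
  then have "annih k g T \<subseteq> {0\<^sub>v k}" by blast
  then have "card (annih k g T) \<le> 1"
    using card_mono[of "{0\<^sub>v k}" "annih k g T"] by simp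
  then have "CARD('a) ^ card T * card (annih k g T) \<le> CARD('a) ^ card T * 1"
    by (rule mult_le_mono2)
  also have "\<dots> < CARD('a) ^ k"
    using power_strict_increasing[OF assms(3) one_less_card_field[where 'a = 'a]] by simp
  finally show False using card_annih_ge[of T g k] assms(1,2) by (meson not_le)
qed

text \<open>Linear independence of the family \<open>(g j)\<close>, \<open>j \<in> T\<close>: each column divides the size of the
  annihilator by \<open>q\<close>. The reverse inequality holds for every family (\<open>card_annih_ge\<close>).\<close>

definition col_independent :: "nat \<Rightarrow> (nat \<Rightarrow> 'a::{field,finite} vec) \<Rightarrow> nat set \<Rightarrow> bool" where
  "col_independent k g T \<longleftrightarrow> CARD('a) ^ card T * card (annih k g T) \<le> CARD('a) ^ k"

lemma col_independent_cong:
  "(\<And>j. j \<in> T \<Longrightarrow> g j = h j) \<Longrightarrow> col_independent k g T \<longleftrightarrow> col_independent k h T"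
  using annih_cong[of T g h k] by (simp add: col_independent_def)

lemma col_independent_empty: "col_independent k g {}"
  by (simp add: col_independent_def annih_def card_carrier_vec)

lemma col_independent_insertI:
  fixes g :: "nat \<Rightarrow> 'a::{field,finite} vec"
  assumes "col_independent k g T" "finite T" "j \<notin> T" "\<And>i. i \<in> insert j T \<Longrightarrow> g i \<in> carrier_vec k"
    and "x \<in> annih k g T" "x \<bullet> g j \<noteq> 0"
  shows "col_independent k g (insert j T)"
proof -
  have "CARD('a) ^ card (insert j T) * card (annih k g (insert j T))
      = CARD('a) ^ card T * (CARD('a) * card (annih k g (insert j T)))"
    using assms(2,3) by simp
  also have "\<dots> \<le> CARD('a) ^ card T * card (annih k g T)"
    using card_annih_insert_le[of g j k T x] assms by (intro mult_le_mono2) auto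
  also have "\<dots> \<le> CARD('a) ^ k" using assms(1) by (simp add: col_independent_def)
  finally show ?thesis by (simp add: col_independent_def)
qed

text \<open>If \<open>g j\<close> were orthogonal to all of \<open>annih k g T\<close>, adjoining it
  would not shrink the annihilator, whose size would then exceed the permitted one by a factor
  \<open>q\<close> because of \<open>card_annih_ge\<close>.\<close>

lemma col_independent_insertD:
  fixes g :: "nat \<Rightarrow> 'a::{field,finite} vec"
  assumes "col_independent k g (insert j T)" "finite T" "j \<notin> T" "\<And>i. g i \<in> carrier_vec k"
  shows "\<exists>x \<in> annih k g T. x \<bullet> g j \<noteq> 0"
proof (rule ccontr)
  assume "\<not> ?thesis"
  then have eq: "annih k g (insert j T) = annih k g T" by (auto simp: annih_def)
  define c where "c = CARD('a) ^ card T * card (annih k g T)"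
  have c: "CARD('a) ^ k \<le> c" unfolding c_def by (rule card_annih_ge[OF assms(2,4)])
  have "CARD('a) * c = CARD('a) ^ card (insert j T) * card (annih k g (insert j T))"
    using assms(2,3) by (simp add: eq c_def)
  also have "\<dots> \<le> CARD('a) ^ k" using assms(1) by (simp add: col_independent_def)
  finally have "CARD('a) * c \<le> 1 * c" using c by linarith
  moreover have "0 < c" using c by (rule less_le_trans[rotated]) simp
  ultimately show False using one_less_card_field[where 'a = 'a] by simp
qed

lemma col_independent_full_annih:
  fixes g :: "nat \<Rightarrow> 'a::{field,finite} vec"
  assumes "col_independent k g T" "card T = k" "\<And>i. g i \<in> carrier_vec k" "x \<in> annih k g T"
  shows "x = 0\<^sub>v k"
proof -
  have "CARD('a) ^ k * card (annih k g T) \<le> CARD('a) ^ k"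
    using assms(1) unfolding col_independent_def assms(2) .
  then have "card (annih k g T) \<le> Suc 0" by simp
  moreover have "0\<^sub>v k \<in> annih k g T" by (rule zero_in_annih[OF assms(3)])
  ultimately show ?thesis
    using assms(4) unfolding card_le_Suc0_iff_eq[OF finite_annih] by blast
qed

section \<open>Greedy choice of columns\<close>

text \<open>Fewer than \<open>q\<close> hyperplanes, none containing the subspace \<open>W\<close>,
  do not cover \<open>W\<close>. The induction moves along a line in \<open>W\<close> whose
  direction \<open>w\<close> avoids all earlier hyperplanes.\<close>

lemma avoid_hyperplanes:
  fixes h :: "'b \<Rightarrow> 'a::{field,finite} vec"
  assumes "finite I" "card I < CARD('a)" "W \<subseteq> carrier_vec k" "W \<noteq> {}"
    and "\<And>a u v. u \<in> W \<Longrightarrow> v \<in> W \<Longrightarrow> u + a \<cdot>\<^sub>v v \<in> W"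
    and "\<And>i. i \<in> I \<Longrightarrow> h i \<in> carrier_vec k"
    and "\<And>i. i \<in> I \<Longrightarrow> \<exists>w\<in>W. h i \<bullet> w \<noteq> 0"
  shows "\<exists>w\<in>W. \<forall>i\<in>I. h i \<bullet> w \<noteq> 0"
  using assms(1,2,6,7)
proof (induction I)
  case empty
  then show ?case using assms(4) by blast
next
  case (insert i0 I)
  then obtain w where w: "w \<in> W" "\<forall>i\<in>I. h i \<bullet> w \<noteq> 0" by auto
  obtain w' where w': "w' \<in> W" "h i0 \<bullet> w' \<noteq> 0" using insert.prems by blast
  \<comment> \<open>For each earlier \<open>i\<close> the line \<open>w' + a w\<close> meets the
    hyperplane of \<open>h i\<close> in exactly one parameter \<open>a\<close>; these parameters are
    excluded.\<close>
  let ?bad = "(\<lambda>i. - (h i \<bullet> w') / (h i \<bullet> w)) ` I"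
  have "card ?bad < CARD('a)"
    using card_image_le[OF insert.hyps(1), of "\<lambda>i. - (h i \<bullet> w') / (h i \<bullet> w)"] insert.hyps insert.prems(1)
    by simp
  then have "?bad \<noteq> UNIV" by force
  then obtain a where a: "a \<notin> ?bad" by blast
  have scal: "h i \<bullet> (w' + a \<cdot>\<^sub>v w) = h i \<bullet> w' + a * (h i \<bullet> w)" if "i \<in> insert i0 I" for i
  proof -
    have "h i \<in> carrier_vec k" "w' \<in> carrier_vec k" "w \<in> carrier_vec k"
      using that insert.prems w w' assms(3) by auto
    then show ?thesis by (simp add: scalar_prod_add_distrib)
  qed
  show ?case
  proof (cases "h i0 \<bullet> w = 0")
    \<comment> \<open>Here \<open>h i0\<close> is constant along the line, with the nonzero value
      \<open>h i0 \<bullet> w'\<close>. In the other case \<open>w\<close> itself already avoids the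
      new hyperplane.\<close>
    case True
    have "h i \<bullet> (w' + a \<cdot>\<^sub>v w) \<noteq> 0" if "i \<in> insert i0 I" for i
    proof (cases "i \<in> I")
      case True
      then have "a \<noteq> - (h i \<bullet> w') / (h i \<bullet> w)" "h i \<bullet> w \<noteq> 0" using a w by auto
      then show ?thesis using scal[OF that] 
        by (metis add_eq_0_iff2 minus_minus nonzero_eq_divide_eq)
    next
      case False
      then show ?thesis using that scal[OF that] True w' by auto
    qed
    then show ?thesis using assms(5) w w' by blast
  next
    case False
    then show ?thesis using w by blast
  qed
qed

text \<open>A set is listed and padded to length \<open>l\<close> with the extra symbol
  \<open>j\<close>; removing \<open>j\<close> recovers it.\<close>

lemma card_small_subsets_le: "card {T. T \<subseteq> {..<j} \<and> card T \<le> l} \<le> Suc j ^ l"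
proof -
  have "{T. T \<subseteq> {..<j} \<and> card T \<le> l} \<subseteq> (\<lambda>xs. set xs - {j}) ` {xs. set xs \<subseteq> {..j} \<and> length xs = l}"
  proof
    fix T assume "T \<in> {T. T \<subseteq> {..<j} \<and> card T \<le> l}"
    then have T: "T \<subseteq> {..<j}" "card T \<le> l" "finite T" using finite_subset by auto
    let ?xs = "sorted_list_of_set T @ replicate (l - card T) j"
    have "set ?xs - {j} = T" "set ?xs \<subseteq> {..j}" "length ?xs = l"
      using T by (auto simp: set_replicate_conv_if)
    then show "T \<in> (\<lambda>xs. set xs - {j}) ` {xs. set xs \<subseteq> {..j} \<and> length xs = l}" by blast
  qed
  moreover have fin: "finite {xs. set xs \<subseteq> {..j} \<and> length xs = l}"
    by (rule finite_lists_length_eq) simp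
  ultimately have "card {T. T \<subseteq> {..<j} \<and> card T \<le> l} \<le> card {xs. set xs \<subseteq> {..j} \<and> length xs = l}"
    by (rule surj_card_le[rotated])
  then show ?thesis by (simp add: card_lists_length_eq)
qed

text \<open>The independent sets of the matroid that the columns are made to represent: the rank-\<open>k\<close>
  truncation of a direct sum of uniform matroids of rank \<open>r\<close> on the blocks of length \<open>s\<close>.\<close>

definition admissible :: "nat \<Rightarrow> nat \<Rightarrow> nat \<Rightarrow> nat set \<Rightarrow> bool" where
  "admissible k r s T \<longleftrightarrow> finite T \<and> card T \<le> k \<and> (\<forall>i. card {j \<in> T. j div s = i} \<le> r)"

lemma admissible_subset: "admissible k r s T \<Longrightarrow> S \<subseteq> T \<Longrightarrow> admissible k r s S"
proof -
  assume T: "admissible k r s T" and S: "S \<subseteq> T"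
  have "card S \<le> card T" "card {j \<in> S. j div s = i} \<le> card {j \<in> T. j div s = i}" for i
    using T S by (auto simp: admissible_def intro!: card_mono)
  then show ?thesis
    using T S finite_subset order_trans unfolding admissible_def by meson
qed

text \<open>The positions in the block of \<open>j\<close> whose columns are to span all columns of
  that block.\<close>

definition block_base :: "nat \<Rightarrow> nat \<Rightarrow> nat \<Rightarrow> nat set" where
  "block_base r s j = {j div s * s..<j div s * s + r}"

lemma mem_block_base_iff:
  assumes "r \<le> s"
  shows "l \<in> block_base r s j \<longleftrightarrow> l div s = j div s \<and> l mod s < r"
proof
  assume "l \<in> block_base r s j"
  then have l: "j div s * s \<le> l" "l < j div s * s + r" by (auto simp: block_base_def)
  then have "l div s = j div s" using assms by (intro div_nat_eqI) (auto simp: mult.commute)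
  moreover from this have "j div s * s + l mod s = l" by (metis div_mult_mod_eq)
  then have "l mod s < r" using l(2) by linarith
  ultimately show "l div s = j div s \<and> l mod s < r" by blast
next
  assume l: "l div s = j div s \<and> l mod s < r"
  then have "j div s * s + l mod s = l" by (metis div_mult_mod_eq)
  then have "j div s * s \<le> l" "l < j div s * s + r" using l by linarith+
  then show "l \<in> block_base r s j" by (simp add: block_base_def)
qed

lemma block_base_less: "l \<in> block_base r s j \<Longrightarrow> r \<le> j mod s \<Longrightarrow> l < j"
  using div_mult_mod_eq[of j s] unfolding block_base_def atLeastLessThan_iff by linarith

text \<open>The greedy choice, by induction on the number \<open>N\<close> of columns chosen. The
  last conjunct says that a column past the first \<open>r\<close> of its block lies in their span.
  Only sets of at most \<open>k - 1\<close> earlier columns constrain the next one, hence the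
  exponent in the bound on the field size.\<close>

lemma exists_columns:
  assumes "n ^ (k - 1) < CARD('a::{field,finite})" "k \<ge> 1" "r \<le> s" "N \<le> n"
  shows "\<exists>g :: nat \<Rightarrow> 'a vec. (\<forall>j. g j \<in> carrier_vec k) \<and>
    (\<forall>T \<subseteq> {..<N}. admissible k r s T \<longrightarrow> col_independent k g T) \<and>
    (\<forall>j < N. r \<le> j mod s \<longrightarrow> (\<forall>x \<in> annih k g (block_base r s j). x \<bullet> g j = 0))"
  using assms(4)
proof (induction N)
  case 0
  show ?case by (rule exI[of _ "\<lambda>_. 0\<^sub>v k"]) (auto simp: col_independent_empty)
next
  case (Suc N)
  from Suc.IH[OF Suc_leD[OF Suc.prems]] obtain g :: "nat \<Rightarrow> 'a vec"
    where g: "\<forall>j. g j \<in> carrier_vec k"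
      "\<forall>T \<subseteq> {..<N}. admissible k r s T \<longrightarrow> col_independent k g T"
      "\<forall>j < N. r \<le> j mod s \<longrightarrow> (\<forall>x \<in> annih k g (block_base r s j). x \<bullet> g j = 0)"
    by (elim exE conjE)
  have car: "g j \<in> carrier_vec k" for j
    using g(1) by simp
  have ind: "col_independent k g T" if "T \<subseteq> {..<N}" "admissible k r s T" for T
    using g(2) that by simp
  have loc: "x \<bullet> g j = 0" if "j < N" "r \<le> j mod s" "x \<in> annih k g (block_base r s j)" for j x
    using g(3) that by simp
  \<comment> \<open>The vectors permitted at position \<open>N\<close>: all of them within the first
    \<open>r\<close> positions of a block, otherwise the span of the block base, written as a double
    annihilator.\<close>
  define W where "W = {v \<in> carrier_vec k. r \<le> N mod s \<longrightarrow>
    (\<forall>x \<in> annih k g (block_base r s N). x \<bullet> v = 0)}"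
  \<comment> \<open>The sets that must stay independent when column \<open>N\<close> joins them. For
    each one a vector \<open>x\<close> of its annihilator is sought whose hyperplane does not
    contain \<open>W\<close>.\<close>
  define I where "I = {T. T \<subseteq> {..<N} \<and> admissible k r s (insert N T)}"
  have I_fin: "finite T" "N \<notin> T" "card T \<le> k - 1" if "T \<in> I" for T
  proof -
    show "finite T" "N \<notin> T" using that finite_subset by (auto simp: I_def)
    then show "card T \<le> k - 1" using that by (auto simp: I_def admissible_def)
  qed
  have "\<exists>x \<in> annih k g T. \<exists>w\<in>W. x \<bullet> w \<noteq> 0" if T: "T \<in> I" for T
  proof (cases "r \<le> N mod s")
    case True
    let ?B = "block_base r s N"
    have B: "?B \<subseteq> {..<N}" using block_base_less True by blast
    \<comment> \<open>Otherwise \<open>T\<close> with \<open>N\<close> would have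
      \<open>r + 1\<close> elements in a single block.\<close>
    have "\<not> ?B \<subseteq> T"
    proof
      assume "?B \<subseteq> T"
      then have "insert N ?B \<subseteq> {j \<in> insert N T. j div s = N div s}"
        using mem_block_base_iff[OF assms(3)] by auto
      then have "card (insert N ?B) \<le> r"
        using T card_mono[of "{j \<in> insert N T. j div s = N div s}" "insert N ?B"]
        by (force simp: I_def admissible_def intro: order_trans)
      moreover have "N \<notin> ?B" using B by blast
      ultimately show False by (simp add: block_base_def)
    qed
    then obtain l where l: "l \<in> ?B" "l \<notin> T" by blast
    \<comment> \<open>Exchanging \<open>N\<close> for \<open>l\<close> stays in the same block, so
      all block counts are kept. The set \<open>insert l T\<close> consists of earlier columns, and
      the induction hypothesis yields an \<open>x\<close> that annihilates \<open>T\<close> but not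
      \<open>g l\<close>, an element of \<open>W\<close>.\<close>
    have "card {j \<in> insert l T. j div s = i} \<le> r" for i
    proof -
      have "card {j \<in> insert l T. j div s = i} = card {j \<in> insert N T. j div s = i}"
      proof (cases "i = N div s")
        case True
        then have "{j \<in> insert l T. j div s = i} = insert l {j \<in> T. j div s = i}"
          "{j \<in> insert N T. j div s = i} = insert N {j \<in> T. j div s = i}"
          using l(1) mem_block_base_iff[OF assms(3)] by auto
        then show ?thesis using I_fin[OF T] l by simp
      next
        case False
        then have "{j \<in> insert l T. j div s = i} = {j \<in> insert N T. j div s = i}"
          using l(1) mem_block_base_iff[OF assms(3)] by auto
        then show ?thesis by simp
      qed
      then show ?thesis using T by (simp add: I_def admissible_def)
    qed
    then have "admissible k r s (insert l T)"
      using I_fin[OF T] l assms(2) by (simp add: admissible_def)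
    then have "col_independent k g (insert l T)"
      using l B T by (intro ind) (auto simp: I_def)
    then obtain x where "x \<in> annih k g T" "x \<bullet> g l \<noteq> 0"
      using col_independent_insertD I_fin[OF T] l car by blast
    moreover have "g l \<in> W" using car l by (auto simp: W_def annih_def)
    ultimately show ?thesis by blast
  next
    case False
    \<comment> \<open>Here \<open>W\<close> is the whole space, so any nonzero \<open>x\<close> in
      the annihilator serves, tested on a unit vector.\<close>
    have "card T < k" using I_fin(3)[OF T] assms(2) by linarith
    then obtain x where x: "x \<in> annih k g T" "x \<noteq> 0\<^sub>v k"
      using exists_annih_nonzero[where g = g, OF I_fin(1)[OF T] car] by blast
    then have xc: "x \<in> carrier_vec k" by (simp add: annih_def)
    then obtain i where "i < k" "x $ i \<noteq> 0"
      using x(2) by (metis carrier_vecD eq_vecI index_zero_vec)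
    then have "x \<bullet> unit_vec k i \<noteq> 0" using xc by simp
    moreover have "unit_vec k i \<in> W" using False by (simp add: W_def)
    ultimately show ?thesis using x by blast
  qed
  then obtain h where h: "\<And>T. T \<in> I \<Longrightarrow> h T \<in> annih k g T" "\<And>T. T \<in> I \<Longrightarrow> \<exists>w\<in>W. h T \<bullet> w \<noteq> 0"
    by metis
  have I_sub: "I \<subseteq> {T. T \<subseteq> {..<N} \<and> card T \<le> k - 1}"
    using I_fin(3) by (auto simp: I_def)
  have fin: "finite {T. T \<subseteq> {..<N} \<and> card T \<le> k - 1}"
    by (rule finite_subset[of _ "Pow {..<N}"]) auto
  have "card I \<le> Suc N ^ (k - 1)"
    using card_mono[OF fin I_sub] card_small_subsets_le order_trans by blast
  also have "\<dots> \<le> n ^ (k - 1)" using Suc.prems by (rule power_mono) simp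
  finally have cardI: "card I < CARD('a)" using assms(1) by simp
  have "\<exists>w\<in>W. \<forall>T\<in>I. h T \<bullet> w \<noteq> 0"
  proof (rule avoid_hyperplanes[OF finite_subset[OF I_sub fin] cardI])
    show "W \<subseteq> carrier_vec k" by (auto simp: W_def)
    have "0\<^sub>v k \<in> W" by (auto simp: W_def annih_def)
    then show "W \<noteq> {}" by blast
    show "u + a \<cdot>\<^sub>v v \<in> W" if "u \<in> W" "v \<in> W" for a u v
      using that by (auto simp: W_def annih_def scalar_prod_add_distrib)
    show "h T \<in> carrier_vec k" if "T \<in> I" for T
      using h(1)[OF that] by (simp add: annih_def)
  qed (use h in blast)
  then obtain w where w: "w \<in> W" "\<And>T. T \<in> I \<Longrightarrow> h T \<bullet> w \<noteq> 0" by blast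
  define g' where "g' = g(N := w)"
  have car': "g' j \<in> carrier_vec k" for j using car w by (auto simp: g'_def W_def)
  have ann': "annih k g' T = annih k g T" if "N \<notin> T" for T
    using that by (intro annih_cong) (auto simp: g'_def)
  have "col_independent k g' T" if T: "T \<subseteq> {..<Suc N}" "admissible k r s T" for T
  proof (cases "N \<in> T")
    case False
    then have "T \<subseteq> {..<N}" using T by (auto simp: less_Suc_eq)
    then show ?thesis
      using ind[OF _ T(2)] col_independent_cong[of T g' g k] False by (metis fun_upd_other g'_def)
  next
    case True
    define U where "U = T - {N}"
    have U: "U \<subseteq> {..<N}" "T = insert N U" "N \<notin> U" using T True by (auto simp: U_def less_Suc_eq)
    then have UI: "U \<in> I" using T by (simp add: I_def)
    have "col_independent k g U" using ind U admissible_subset[OF T(2)] by blast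
    then have "col_independent k g' U"
      using col_independent_cong[of U g' g k] U(3) by (metis fun_upd_other g'_def)
    then show ?thesis unfolding U(2)
    proof (rule col_independent_insertI)
      show "h U \<in> annih k g' U" using h(1)[OF UI] ann' U by simp
      show "h U \<bullet> g' N \<noteq> 0" using w UI by (simp add: g'_def)
    qed (use U I_fin[OF UI] car' in auto)
  qed
  moreover have "x \<bullet> g' j = 0"
    if "j < Suc N" "r \<le> j mod s" "x \<in> annih k g' (block_base r s j)" for j x
  proof -
    \<comment> \<open>The base of a block precedes the positions constrained by it, so changing
      column \<open>N\<close> affects no base in question.\<close>
    have "N \<notin> block_base r s j" using that block_base_less by fastforce
    then have "x \<in> annih k g (block_base r s j)" using that ann' by blast
    then show ?thesis using that loc w by (cases "j = N") (auto simp: g'_def W_def)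
  qed
  ultimately show ?case using car' by blast
qed

section \<open>Zeros of codewords\<close>

text \<open>From each block up to \<open>r\<close> elements of \<open>Z\<close> are kept. If more
  than \<open>p\<close> blocks contain at least \<open>r\<close> elements, these alone give
  \<open>Suc p * r\<close>; otherwise elements are lost in at most \<open>p\<close> blocks, and at
  most \<open>s - r\<close> in each.\<close>

lemma exists_admissible_subset:
  assumes s: "0 < s" "r \<le> s" and Z: "Z \<subseteq> {..<m * s}"
    and card: "Suc l + p * (s - r) \<le> card Z" and l: "Suc l \<le> Suc p * r"
  shows "\<exists>T \<subseteq> Z. card T = Suc l \<and> admissible (Suc l) r s T"
proof -
  have finZ: "finite Z" using Z finite_subset by blast
  define z where "z i = {j \<in> Z. j div s = i}" for i
  have finz: "finite (z i)" for i using finZ by (simp add: z_def)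
  have "\<exists>U. U \<subseteq> z i \<and> card U = min r (card (z i))" for i
    by (rule obtain_subset_with_card_n[OF min.cobounded2[of r "card (z i)"]]) blast
  then have "\<exists>U. \<forall>i. U i \<subseteq> z i \<and> card (U i) = min r (card (z i))" by (intro choice allI)
  then obtain U where U: "\<And>i. U i \<subseteq> z i" "\<And>i. card (U i) = min r (card (z i))" by blast
  have disj: "U i \<inter> U j = {}" if "i \<noteq> j" for i j
    using U(1)[of i] U(1)[of j] that by (auto simp: z_def)
  have finU: "finite (U i)" for i using U finz finite_subset by blast
  have "Z = (\<Union>i<m. z i)"
    using Z by (auto simp: z_def less_mult_imp_div_less)
  then have cardZ: "card Z = (\<Sum>i<m. card (z i))"
    using finz by (subst card_UN_disjoint[symmetric]) (auto simp: z_def)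
  have zs: "card (z i) \<le> s" for i
  proof -
    have "z i \<subseteq> {i * s..<i * s + s}"
    proof
      fix j assume "j \<in> z i"
      then have "i * s + j mod s = j" by (auto simp: z_def)
      then have "i * s \<le> j" "j < i * s + s" using mod_less_divisor[OF s(1), of j] by linarith+
      then show "j \<in> {i * s..<i * s + s}" by simp
    qed
    then show ?thesis using card_mono[of "{i * s..<i * s + s}" "z i"] by simp
  qed
  define A where "A = {i. i < m \<and> r \<le> card (z i)}"
  have A: "A \<subseteq> {..<m}" "finite A" by (auto simp: A_def)
  have "Suc l \<le> (\<Sum>i<m. card (U i))"
  proof (cases "Suc p \<le> card A")
    case True
    note l
    also have "Suc p * r \<le> card A * r" using True by (rule mult_le_mono1)
    also have "\<dots> = (\<Sum>i\<in>A. card (U i))" using U(2) by (simp add: A_def)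
    also have "\<dots> \<le> (\<Sum>i<m. card (U i))" using A by (intro sum_mono2) auto
    finally show ?thesis .
  next
    case False
    have "card Z \<le> (\<Sum>i<m. card (U i) + (if i \<in> A then s - r else 0))"
      unfolding cardZ
    proof (rule sum_mono)
      fix i assume "i \<in> {..<m}"
      then show "card (z i) \<le> card (U i) + (if i \<in> A then s - r else 0)"
        using zs[of i] s(2) by (auto simp: U(2) A_def)
    qed
    also have "\<dots> = (\<Sum>i<m. card (U i)) + card A * (s - r)"
      using A by (simp add: sum.distrib sum.If_cases Int_absorb1 Int_absorb2)
    also have "\<dots> \<le> (\<Sum>i<m. card (U i)) + p * (s - r)" using False by (simp add: mult_le_mono1)
    finally show ?thesis using card by linarith
  qed
  also have "\<dots> = card (\<Union>i<m. U i)"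
    using finU disj by (subst card_UN_disjoint) auto
  finally obtain T where T: "T \<subseteq> (\<Union>i<m. U i)" "card T = Suc l" "finite T"
    by (rule obtain_subset_with_card_n)
  have "{j \<in> T. j div s = i} \<subseteq> U i" for i
  proof
    fix j assume j: "j \<in> {j \<in> T. j div s = i}"
    then obtain i' where i': "j \<in> U i'" using T(1) by blast
    then have "j div s = i'" using U(1)[of i'] by (auto simp: z_def)
    then show "j \<in> U i" using i' j by simp
  qed
  then have "card {j \<in> T. j div s = i} \<le> card (U i)" for i
    by (rule card_mono[OF finU])
  then have "card {j \<in> T. j div s = i} \<le> r" for i
    unfolding U(2) by (rule order_trans) simp
  then have "admissible (Suc l) r s T" using T(2,3) by (simp add: admissible_def)
  moreover have "U i \<subseteq> Z" for i using U(1)[of i] by (auto simp: z_def)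
  then have "T \<subseteq> Z" using T(1) by blast
  ultimately show ?thesis using T(2) by blast
qed

text \<open>There are \<open>m\<close> blocks of length \<open>s\<close>, and the bounds on
  \<open>k\<close> say that \<open>p\<close> is \<open>\<lceil>k/r\<rceil> - 1\<close>. In the
  application \<open>s - r\<close> is \<open>\<delta> - 1\<close>.\<close>

locale lrc_columns =
  fixes k r s m p :: nat and g :: "nat \<Rightarrow> 'a::{field,finite} vec"
  assumes col_carrier: "\<And>j. g j \<in> carrier_vec k"
    and ind: "\<And>T. T \<subseteq> {..<m * s} \<Longrightarrow> admissible k r s T \<Longrightarrow> col_independent k g T"
    and base_annih: "\<And>j x. j < m * s \<Longrightarrow> r \<le> j mod s \<Longrightarrow> x \<in> annih k g (block_base r s j)
      \<Longrightarrow> x \<bullet> g j = 0"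
    and r_pos: "1 \<le> r" and r_le_s: "r \<le> s"
    and k_lower: "p * r < k" and k_upper: "k \<le> Suc p * r" and p_less: "p < m"
begin

lemma k_pos: "0 < k"
  using k_lower by simp

lemma s_pos: "0 < s"
  using r_pos r_le_s by simp

lemma annih_base_block:
  assumes "x \<in> annih k g (block_base r s j)" "l < m * s" "l div s = j div s"
  shows "x \<bullet> g l = 0"
proof (cases "l mod s < r")
  case True
  then have "l \<in> block_base r s j"
    using assms(3) mem_block_base_iff[OF r_le_s] by simp
  then show ?thesis using assms(1) by (simp add: annih_def)
next
  case False
  then show ?thesis using base_annih[of l x] assms by (simp add: block_base_def)
qed

text \<open>With \<open>r\<close> zeros in the block there is an independent set \<open>T\<close> of
  \<open>min k r\<close> zeros. If \<open>k \<le> r\<close>, this forces \<open>x\<close> to be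
  zero. Otherwise \<open>T\<close> has \<open>r\<close> independent columns in the span of the
  \<open>r\<close> base columns, so comparing cardinalities shows that both annihilators agree, and
  \<open>x\<close> vanishes on the entire block.\<close>

lemma few_zeros_in_block:
  assumes x: "x \<in> carrier_vec k" and l: "l < m * s" "x \<bullet> g l \<noteq> 0"
  shows "card {j. j < m * s \<and> j div s = l div s \<and> x \<bullet> g j = 0} < r"
proof (rule ccontr)
  let ?Z = "{j. j < m * s \<and> j div s = l div s \<and> x \<bullet> g j = 0}"
  assume "\<not> card ?Z < r"
  then have "min k r \<le> card ?Z" by simp
  then obtain T where T: "T \<subseteq> ?Z" "card T = min k r" "finite T"
    by (rule obtain_subset_with_card_n)
  have "card {j \<in> T. j div s = i} \<le> card T" for i
    by (rule card_mono[OF T(3)]) simp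
  then have "card {j \<in> T. j div s = i} \<le> r" for i
    unfolding T(2) by (rule order_trans) simp
  then have "admissible k r s T" using T by (simp add: admissible_def)
  then have indT: "col_independent k g T" using T by (intro ind) auto
  have xT: "x \<in> annih k g T" using x T by (auto simp: annih_def)
  show False
  proof (cases "k \<le> r")
    case True
    then have "x = 0\<^sub>v k" using col_independent_full_annih[where g = g, OF indT _ col_carrier xT] T by simp
    then show False using l col_carrier by simp
  next
    case False
    let ?B = "block_base r s l"
    have "x \<in> annih k g T" if x: "x \<in> annih k g ?B" for x
      using annih_base_block[OF x] T(1) x by (fastforce simp: annih_def)
    then have sub: "annih k g ?B \<subseteq> annih k g T" by blast
    have "CARD('a) ^ r * card (annih k g T) \<le> CARD('a) ^ k"
      using indT T False by (simp add: col_independent_def)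
    also have "\<dots> \<le> CARD('a) ^ r * card (annih k g ?B)"
      using card_annih_ge[of ?B g k] col_carrier by (simp add: block_base_def)
    finally have "card (annih k g T) \<le> card (annih k g ?B)" by simp
    then have "annih k g ?B = annih k g T"
      using card_seteq[OF finite_annih sub] by blast
    then show False using xT annih_base_block[of x l l] l by simp
  qed
qed

text \<open>That many zeros would contain an admissible set of size \<open>k\<close>, whose
  annihilator is trivial.\<close>

lemma card_zeros_le:
  assumes x: "x \<in> carrier_vec k" "x \<noteq> 0\<^sub>v k"
  shows "card {j. j < m * s \<and> x \<bullet> g j = 0} < k + p * (s - r)"
proof (rule ccontr)
  let ?Z = "{j. j < m * s \<and> x \<bullet> g j = 0}"
  assume "\<not> ?thesis"
  moreover obtain l where l: "k = Suc l" using k_pos gr0_implies_Suc by blast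
  ultimately obtain T where T: "T \<subseteq> ?Z" "card T = k" "admissible k r s T"
    using exists_admissible_subset[OF s_pos r_le_s, of ?Z m l p] k_upper by auto
  have "x \<in> annih k g T" using T x by (auto simp: annih_def)
  moreover have "col_independent k g T" using T by (intro ind) auto
  ultimately show False using col_independent_full_annih[where g = g, OF _ T(2) col_carrier] x by blast
qed

text \<open>The converse bound: imposing zeros only at base positions costs fewer than
  \<open>k\<close> equations, and the other positions of \<open>p\<close> full blocks vanish for
  free, which gains \<open>p * (s - r)\<close> zeros.\<close>

lemma exists_many_zeros:
  "\<exists>x \<in> carrier_vec k. x \<noteq> 0\<^sub>v k \<and>
    k + p * (s - r) \<le> Suc (card {j. j < m * s \<and> x \<bullet> g j = 0})"
proof -
  \<comment> \<open>The \<open>k - 1\<close> available equations cover the bases of \<open>p\<close>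
    blocks and leave \<open>k - 1 - p * r < r\<close> further positions, all in the base of the next
    block. Thus \<open>N\<close> is \<open>k - 1 + p * (s - r)\<close>.\<close>
  define N where "N = p * s + (k - 1 - p * r)"
  have rem: "k - 1 - p * r < r" using k_upper k_lower unfolding mult_Suc by linarith
  have "N < Suc p * s" using rem r_le_s by (simp add: N_def)
  also have "\<dots> \<le> m * s" using p_less by (intro mult_le_mono1) simp
  finally have N: "N < m * s" .
  let ?T = "{j. j < N \<and> j mod s < r}"
  have "?T \<subseteq> (\<Union>i<p. {i * s..<i * s + r}) \<union> {p * s..<N}"
  proof
    fix j assume j: "j \<in> ?T"
    show "j \<in> (\<Union>i<p. {i * s..<i * s + r}) \<union> {p * s..<N}"
    proof (cases "j < p * s")
      case True
      then have "j div s < p" by (rule less_mult_imp_div_less)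
      moreover have "j \<in> {j div s * s..<j div s * s + r}"
        using j mem_block_base_iff[OF r_le_s, of j j] by (simp add: block_base_def)
      ultimately show ?thesis by blast
    qed (use j in auto)
  qed
  then have "card ?T \<le> card ((\<Union>i<p. {i * s..<i * s + r}) \<union> {p * s..<N})"
    by (intro card_mono) auto
  also have "\<dots> \<le> card (\<Union>i<p. {i * s..<i * s + r}) + card {p * s..<N}" by (rule card_Un_le)
  also have "\<dots> \<le> p * r + (k - 1 - p * r)"
    using card_UN_le[of "{..<p}" "\<lambda>i. {i * s..<i * s + r}"] by (simp add: N_def)
  also have "\<dots> < k" using k_lower by simp
  finally obtain x where x: "x \<in> annih k g ?T" "x \<noteq> 0\<^sub>v k"
    using exists_annih_nonzero[of ?T g k] col_carrier by auto
  have "x \<bullet> g j = 0" if j: "j < N" for j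
  proof (cases "j mod s < r")
    case True
    then show ?thesis using x j by (simp add: annih_def)
  next
    case False
    have "l \<in> ?T" if l: "l \<in> block_base r s j" for l
    proof -
      have "l < j" using block_base_less[OF l] False by simp
      moreover have "l mod s < r" using l mem_block_base_iff[OF r_le_s] by simp
      ultimately show ?thesis using j by simp
    qed
    then have "x \<in> annih k g (block_base r s j)" using x(1) annih_mono by blast
    then show ?thesis using base_annih[of j x] False j N by simp
  qed
  then have "{..<N} \<subseteq> {j. j < m * s \<and> x \<bullet> g j = 0}" using N by auto
  then have "N \<le> card {j. j < m * s \<and> x \<bullet> g j = 0}"
    using card_mono[of "{j. j < m * s \<and> x \<bullet> g j = 0}" "{..<N}"] by simp
  moreover have "k + p * (s - r) \<le> Suc N"
    using k_lower mult_le_mono2[OF r_le_s, of p] unfolding N_def diff_mult_distrib2 by linarith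
  moreover have "x \<in> carrier_vec k" using x by (simp add: annih_def)
  ultimately show ?thesis using x(2) by (meson le_trans not_less_eq_eq Suc_le_mono)
qed

text \<open>Singletons are admissible, so no column is zero. This makes the code and its
  restrictions to blocks nontrivial, whereas \<open>min_distance\<close> is 0 by default on trivial
  codes.\<close>

lemma exists_nonzero_at:
  assumes "l < m * s"
  shows "\<exists>x \<in> carrier_vec k. x \<bullet> g l \<noteq> 0"
proof -
  have "card {j \<in> {l}. j div s = i} \<le> card {l}" for i
    by (rule card_mono) auto
  then have "card {j \<in> {l}. j div s = i} \<le> r" for i
    by (rule order_trans) (use r_pos in simp)
  then have "admissible k r s (insert l {})" using k_pos by (simp add: admissible_def)
  then have "col_independent k g (insert l {})" using assms by (intro ind) auto
  then have "\<exists>x \<in> annih k g {}. x \<bullet> g l \<noteq> 0"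
    by (rule col_independent_insertD) (simp_all add: col_carrier)
  then show ?thesis by (simp add: annih_def)
qed

end

section \<open>The code\<close>

lemma (in vec_space) rank_le_nr:
  assumes "A \<in> carrier_mat n nc"
  shows "rank A \<le> n"
proof -
  have "set (cols A) \<subseteq> carrier_vec n" using assms cols_dim by blast
  then have "VectorSpace.subspace class_ring (span (set (cols A))) V" by (intro span_is_subspace) simp
  from subspace_dim[OF this fin_dim fin_dim_span_cols[OF assms]] show ?thesis
    unfolding rank_def dim_is_n .
qed

text \<open>Independence is stated for the set of columns, so repeated columns are excluded first:
  two equal columns put a difference of unit vectors into the kernel.\<close>

lemma (in vec_space) rank_eq_nc_if_inj:
  assumes A: "A \<in> carrier_mat n nc"
    and inj: "\<And>v. v \<in> carrier_vec nc \<Longrightarrow> A *\<^sub>v v = 0\<^sub>v n \<Longrightarrow> v = 0\<^sub>v nc"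
  shows "rank A = nc"
proof -
  have dist: "distinct (cols A)"
  proof (rule ccontr)
    assume "\<not> distinct (cols A)"
    then obtain i j where ij: "i \<noteq> j" "i < nc" "j < nc" "col A i = col A j"
      using A by (auto simp: distinct_conv_nth)
    let ?v = "unit_vec nc i - unit_vec nc j :: 'a vec"
    have "A *\<^sub>v ?v = 0\<^sub>v n"
    proof (rule eq_vecI)
      fix l assume "l < dim_vec (0\<^sub>v n :: 'a vec)"
      then have l: "l < n" by simp
      have "row A l \<bullet> ?v = row A l \<bullet> unit_vec nc i - row A l \<bullet> unit_vec nc j"
        using A by (intro scalar_prod_minus_distrib[of _ nc]) auto
      moreover have "A $$ (l, i) = A $$ (l, j)"
        using arg_cong[OF ij(4), of "\<lambda>w. w $ l"] A l ij(2,3) by simp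
      ultimately show "(A *\<^sub>v ?v) $ l = 0\<^sub>v n $ l" using A l ij by simp
    qed (use A in simp)
    then have "?v = 0\<^sub>v nc" by (intro inj) auto
    then have "?v $ i = 0" using ij by simp
    then show False using ij by simp
  qed
  moreover have "lin_indpt (set (cols A))"
    using lin_depE[OF A _ dist] inj by metis
  ultimately show ?thesis by (rule lin_indpt_full_rank[OF A])
qed

lemma min_distance_ge:
  assumes "\<exists>x\<in>C. \<exists>y\<in>C. x \<noteq> y"
    and "\<And>x y. x \<in> C \<Longrightarrow> y \<in> C \<Longrightarrow> x \<noteq> y \<Longrightarrow> d \<le> hamming_distance x y"
  shows "d \<le> min_distance C"
proof -
  let ?D = "{hamming_distance x y | x y. x \<in> C \<and> y \<in> C \<and> x \<noteq> y}"
  have ne: "?D \<noteq> {}" using assms(1) by blast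
  then have "d \<le> Inf ?D" using assms(2) by (intro cInf_greatest) auto
  then show ?thesis unfolding min_distance_def Let_def if_not_P[OF ne] .
qed

lemma min_distance_le:
  assumes "x \<in> C" "y \<in> C" "x \<noteq> y"
  shows "min_distance C \<le> hamming_distance x y"
proof -
  let ?D = "{hamming_distance x y | x y. x \<in> C \<and> y \<in> C \<and> x \<noteq> y}"
  have "hamming_distance x y \<in> ?D" using assms by blast
  moreover from this have "Inf ?D \<le> hamming_distance x y" by (intro cInf_lower) auto
  ultimately show ?thesis by (auto simp: min_distance_def)
qed

lemma submatrix_UNIV_lessThan_dim_col:
  assumes "A \<in> carrier_mat nr nc"
  shows "submatrix A UNIV {..<nc} = A"
proof (rule eq_matI)
  have col: "{j. j < dim_col A \<and> j \<in> {..<nc}} = {..<nc}" using assms by auto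
  show "dim_row (submatrix A UNIV {..<nc}) = dim_row A" "dim_col (submatrix A UNIV {..<nc}) = dim_col A"
    unfolding dim_submatrix col using assms by simp_all
  fix i j assume ij: "i < dim_row A" "j < dim_col A"
  then have "pick {..<nc} j = j"
    using pick_reduce_set[of j nc UNIV] pick_UNIV assms by (simp add: lessThan_def)
  then show "submatrix A UNIV {..<nc} $$ (i, j) = A $$ (i, j)"
    using ij assms unfolding submatrix_def col by (simp add: pick_UNIV)
qed

lemma pick_interval:
  assumes "j < s"
  shows "pick {a..<a + s} j = a + j"
proof -
  have "{b \<in> {a..<a + s}. b < a + j} = {a..<a + j}" using assms by auto
  then show ?thesis using pick_card_in_set[of "a + j" "{a..<a + s}"] assms by simp
qed

section \<open>Dimension, minimum distance and locality of the constructed code\<close>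

context lrc_columns
begin

definition gen :: "'a mat" where
  "gen = mat k (m * s) (\<lambda>(i, j). g j $ i)"

definition codeword :: "'a vec \<Rightarrow> 'a vec" where
  "codeword x = vec (m * s) (\<lambda>j. x \<bullet> g j)"

definition code :: "'a vec set" where
  "code = codeword ` carrier_vec k"

lemma gen_carrier: "gen \<in> carrier_mat k (m * s)"
  by (simp add: gen_def)

lemma col_gen: "j < m * s \<Longrightarrow> col gen j = g j"
  using col_carrier[of j] by (auto simp: gen_def)

lemma codeword_eq_mult:
  assumes "x \<in> carrier_vec k"
  shows "gen\<^sup>T *\<^sub>v x = codeword x"
proof (rule eq_vecI)
  fix j assume "j < dim_vec (codeword x)"
  then have j: "j < m * s" by (simp add: codeword_def)
  then show "(gen\<^sup>T *\<^sub>v x) $ j = codeword x $ j"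
    using gen_carrier comm_scalar_prod[OF assms col_carrier[of j]]
    by (simp add: codeword_def col_gen)
qed (use gen_carrier in \<open>simp add: codeword_def\<close>)

lemma row_space_gen: "vec_space.row_space (m * s) gen = code"
proof -
  interpret V: vec_space "TYPE('a)" "m * s" .
  have "V.row_space gen = {w \<in> carrier_vec (m * s). \<exists>y \<in> carrier_vec k. gen\<^sup>T *\<^sub>v y = w}"
    using V.row_space_eq[OF gen_carrier] gen_carrier by simp
  also have "\<dots> = code"
    using codeword_eq_mult by (auto simp: code_def codeword_def)
  finally show ?thesis .
qed

lemma codeword_eq_iff:
  assumes "x \<in> carrier_vec k" "y \<in> carrier_vec k" "j < m * s"
  shows "codeword x $ j = codeword y $ j \<longleftrightarrow> (x - y) \<bullet> g j = 0"
  using assms col_carrier[of j]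
  by (simp add: codeword_def minus_scalar_prod_distrib)

text \<open>The set of all coordinates is large enough for \<open>exists_admissible_subset\<close>,
  since \<open>k + p * (s - r) \<le> r + p * s \<le> m * s\<close>.\<close>

lemma exists_admissible_basis:
  "\<exists>T \<subseteq> {..<m * s}. card T = k \<and> admissible k r s T"
proof -
  obtain l where l: "k = Suc l" using k_pos gr0_implies_Suc by blast
  have "k + p * (s - r) \<le> Suc p * r + p * (s - r)" using k_upper by simp
  also have "\<dots> = r + p * s" using mult_le_mono2[OF r_le_s, of p] by (simp add: diff_mult_distrib2)
  also have "\<dots> \<le> Suc p * s" using r_le_s by simp
  also have "\<dots> \<le> m * s" using p_less by (intro mult_le_mono1) simp
  finally show ?thesis
    using exists_admissible_subset[OF s_pos r_le_s, of "{..<m * s}" m l p] k_upper l by simp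
qed

lemma annih_all:
  assumes "x \<in> carrier_vec k" "\<And>j. j < m * s \<Longrightarrow> x \<bullet> g j = 0"
  shows "x = 0\<^sub>v k"
proof -
  obtain T where T: "T \<subseteq> {..<m * s}" "card T = k" "admissible k r s T"
    using exists_admissible_basis by blast
  have "x \<in> annih k g T" using assms T(1) by (auto simp: annih_def)
  then show ?thesis using col_independent_full_annih[where g = g, OF ind[OF T(1,3)] T(2) col_carrier] by blast
qed

text \<open>The columns in an admissible set of size \<open>k\<close> form a nonsingular minor: a
  kernel vector of its transpose annihilates these columns and is therefore zero.\<close>

lemma rank_gen: "vec_space.rank k gen = k"
proof -
  interpret V: vec_space "TYPE('a)" k .
  obtain T where T: "T \<subseteq> {..<m * s}" "card T = k" "admissible k r s T"
    using exists_admissible_basis by blast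
  have T_eq: "{j. j < m * s \<and> j \<in> T} = T" using T(1) by auto
  let ?B = "submatrix gen UNIV T"
  have B: "?B \<in> carrier_mat k k"
    using gen_carrier T by (intro carrier_matI) (simp_all add: dim_submatrix T_eq)
  have colB: "col ?B c = g (pick T c)" if c: "c < k" for c
  proof (rule eq_vecI)
    have pT: "pick T c < m * s" using pick_in_set_le[of c T] T c by auto
    show "dim_vec (col ?B c) = dim_vec (g (pick T c))"
      using B col_carrier[of "pick T c"] by simp
    fix i assume "i < dim_vec (g (pick T c))"
    then have i: "i < k" using col_carrier[of "pick T c"] by simp
    have "?B $$ (i, c) = gen $$ (pick UNIV i, pick T c)"
      using gen_carrier i c T by (intro submatrix_index) (simp_all add: T_eq)
    then show "col ?B c $ i = g (pick T c) $ i"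
      using B i c pT by (simp add: pick_UNIV gen_def)
  qed
  have "det ?B \<noteq> 0"
  proof
    assume "det ?B = 0"
    then have "det ?B\<^sup>T = 0" using det_transpose[OF B] by simp
    then obtain v where v: "v \<in> carrier_vec k" "v \<noteq> 0\<^sub>v k" "?B\<^sup>T *\<^sub>v v = 0\<^sub>v k"
      using det_0_iff_vec_prod_zero_field[of "?B\<^sup>T" k] B by auto
    have "v \<bullet> g j = 0" if j: "j \<in> T" for j
    proof -
      \<comment> \<open>The index at which column \<open>j\<close> of \<open>gen\<close> occurs in
        the submatrix, so that \<open>pick T ?c\<close> is \<open>j\<close>.\<close>
      let ?c = "card {a \<in> T. a < j}"
      have "{a \<in> T. a < j} \<subset> T" using j by auto
      then have c: "?c < k" using psubset_card_mono[of T] T by (auto simp: admissible_def)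
      have "(?B\<^sup>T *\<^sub>v v) $ ?c = g j \<bullet> v"
        using B c colB[OF c] pick_card_in_set[OF j] by simp
      then show ?thesis using v(1,3) c comm_scalar_prod[OF v(1) col_carrier[of j]] by simp
    qed
    then have "v \<in> annih k g T" using v by (simp add: annih_def)
    then show False
      using col_independent_full_annih[where g = g, OF ind[OF T(1,3)] T(2) col_carrier] v by blast
  qed
  then have "k \<le> V.rank gen"
    using V.rank_gt_minor[OF gen_carrier, of UNIV T] T T_eq by simp
  then show ?thesis using V.rank_le_nr[OF gen_carrier] by simp
qed

lemma generator_matrix_gen: "generator_matrix (m * s) k code gen"
  by (simp add: generator_matrix_def gen_carrier row_space_gen rank_gen)

lemma subspace_code: "VectorSpace.subspace class_ring code (module_vec TYPE('a) (m * s))"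
proof -
  interpret V: vec_space "TYPE('a)" "m * s" .
  have "set (rows gen) \<subseteq> carrier_vec (m * s)" using gen_carrier rows_carrier[of gen] by simp
  then show ?thesis
    using V.span_is_subspace[of "set (rows gen)"] row_space_gen by (simp add: V.row_space_def)
qed

text \<open>The code is the column space of the transpose of \<open>gen\<close>, and encoding is
  injective by \<open>annih_all\<close>.\<close>

lemma dim_code: "vectorspace.dim class_ring (module_vec TYPE('a) (m * s)\<lparr>carrier := code\<rparr>) = k"
proof -
  interpret V: vec_space "TYPE('a)" "m * s" .
  have "V.rank gen\<^sup>T = k"
  proof (rule V.rank_eq_nc_if_inj)
    fix v assume v: "v \<in> carrier_vec k" "gen\<^sup>T *\<^sub>v v = 0\<^sub>v (m * s)"
    have "v \<bullet> g j = 0" if "j < m * s" for j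
      using arg_cong[OF v(2), of "\<lambda>w. w $ j"] that codeword_eq_mult[OF v(1)]
      by (simp add: codeword_def)
    then show "v = 0\<^sub>v k" using annih_all v(1) by blast
  qed (use gen_carrier in simp)
  then show ?thesis
    using row_space_gen unfolding V.rank_def V.row_space_def by simp
qed

lemma hamming_distance_codeword:
  assumes "x \<in> carrier_vec k" "y \<in> carrier_vec k"
  shows "hamming_distance (codeword x) (codeword y) + card {j. j < m * s \<and> (x - y) \<bullet> g j = 0} = m * s"
proof -
  have "hamming_distance (codeword x) (codeword y) = card {j. j < m * s \<and> (x - y) \<bullet> g j \<noteq> 0}"
    unfolding hamming_distance_def
    using codeword_eq_iff[where x = x and y = y] assms by (intro arg_cong[of _ _ card]) (auto simp: codeword_def)
  moreover have "card ({j. j < m * s \<and> (x - y) \<bullet> g j \<noteq> 0} \<union> {j. j < m * s \<and> (x - y) \<bullet> g j = 0})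
     = card {j. j < m * s \<and> (x - y) \<bullet> g j \<noteq> 0} + card {j. j < m * s \<and> (x - y) \<bullet> g j = 0}"
    by (rule card_Un_disjoint) auto
  moreover have "{j. j < m * s \<and> (x - y) \<bullet> g j \<noteq> 0} \<union> {j. j < m * s \<and> (x - y) \<bullet> g j = 0} = {..<m * s}"
    by auto
  ultimately show ?thesis by simp
qed

text \<open>Distances are numbers of nonzeros of difference codewords, so
  \<open>exists_many_zeros\<close> gives one inequality and \<open>card_zeros_le\<close> the other.
  The additive form avoids truncated subtraction.\<close>

lemma min_distance_code: "min_distance code + k + p * (s - r) = Suc (m * s)"
proof (rule antisym)
  obtain x where x: "x \<in> carrier_vec k" "x \<noteq> 0\<^sub>v k"
    "k + p * (s - r) \<le> Suc (card {j. j < m * s \<and> x \<bullet> g j = 0})"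
    using exists_many_zeros by blast
  have "codeword x \<noteq> codeword (0\<^sub>v k)"
  proof
    assume eq: "codeword x = codeword (0\<^sub>v k)"
    have "x \<bullet> g j = 0" if "j < m * s" for j
      using arg_cong[OF eq, of "\<lambda>w. w $ j"] that col_carrier[of j] by (simp add: codeword_def)
    then show False using annih_all x by blast
  qed
  then have "min_distance code \<le> hamming_distance (codeword x) (codeword (0\<^sub>v k))"
    using x(1) by (intro min_distance_le) (auto simp: code_def)
  then show "min_distance code + k + p * (s - r) \<le> Suc (m * s)"
    using hamming_distance_codeword[of x "0\<^sub>v k"] x by (simp add: minus_zero_vec)
next
  have lower: "Suc (m * s) - (k + p * (s - r)) \<le> hamming_distance c c'"
    if cc: "c \<in> code" "c' \<in> code" "c \<noteq> c'" for c c'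
  proof -
    obtain x y where xy: "x \<in> carrier_vec k" "y \<in> carrier_vec k" "c = codeword x" "c' = codeword y"
      using cc by (auto simp: code_def)
    have "x - y \<noteq> 0\<^sub>v k"
    proof
      assume "x - y = 0\<^sub>v k"
      then have "codeword x $ j = codeword y $ j" if "j < m * s" for j
        using codeword_eq_iff[OF xy(1,2) that] col_carrier[of j] by simp
      then have "codeword x = codeword y" by (intro eq_vecI) (simp_all add: codeword_def)
      then show False using cc xy by simp
    qed
    then have "card {j. j < m * s \<and> (x - y) \<bullet> g j = 0} < k + p * (s - r)"
      using xy by (intro card_zeros_le) auto
    then show ?thesis using hamming_distance_codeword[OF xy(1,2)] unfolding xy(3,4) by linarith
  qed
  obtain x where x: "x \<in> carrier_vec k" "x \<bullet> g 0 \<noteq> 0"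
    using exists_nonzero_at[of 0] p_less s_pos by auto
  have "codeword x $ 0 \<noteq> codeword (0\<^sub>v k) $ 0"
    using x p_less s_pos col_carrier[of 0] by (simp add: codeword_def)
  then have "\<exists>c\<in>code. \<exists>c'\<in>code. c \<noteq> c'" using x(1) unfolding code_def
    by (metis imageI zero_carrier_vec)
  from min_distance_ge[OF this lower] show "Suc (m * s) \<le> min_distance code + k + p * (s - r)"
    by linarith
qed

text \<open>A difference that is nonzero somewhere in the block has at most \<open>r - 1\<close>
  zeros there, hence at least \<open>s - r + 1\<close> nonzeros.\<close>

lemma puncture_block_distance:
  assumes i: "i < m"
  shows "Suc (s - r) \<le> min_distance (puncture {i * s..<i * s + s} code)"
proof -
  let ?S = "{i * s..<i * s + s}"
  have bound: "i * s + j < m * s" if "j < s" for j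
  proof -
    have "i * s + j < Suc i * s" using that by simp
    also have "\<dots> \<le> m * s" using i by (intro mult_le_mono1) simp
    finally show ?thesis .
  qed
  define P where "P x = vec s (\<lambda>j. x \<bullet> g (i * s + j))" for x
  have S: "{l. l < m * s \<and> l \<in> ?S} = ?S"
  proof -
    have "l < m * s" if "l \<in> ?S" for l
    proof -
      have "l = i * s + (l - i * s)" "l - i * s < s" using that by auto
      then show ?thesis using bound by metis
    qed
    then show ?thesis by blast
  qed
  have "puncture ?S code = P ` carrier_vec k"
    unfolding puncture_def code_def image_image
  proof (rule image_cong[OF refl])
    fix x :: "'a vec"
    show "vec (card {l. l < dim_vec (codeword x) \<and> l \<in> ?S}) (\<lambda>j. codeword x $ pick ?S j) = P x"
      unfolding P_def using S bound
      by (intro eq_vecI) (simp_all add: codeword_def pick_interval)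
  qed
  moreover have "Suc (s - r) \<le> min_distance (P ` carrier_vec k)"
  proof (rule min_distance_ge)
    obtain x where x: "x \<in> carrier_vec k" "x \<bullet> g (i * s) \<noteq> 0"
      using exists_nonzero_at[of "i * s"] bound[of 0] s_pos by auto
    have "P x $ 0 \<noteq> P (0\<^sub>v k) $ 0"
      using x s_pos col_carrier[of "i * s"] by (simp add: P_def)
    then show "\<exists>c \<in> P ` carrier_vec k. \<exists>c' \<in> P ` carrier_vec k. c \<noteq> c'"
      using x(1) by (metis imageI zero_carrier_vec)
  next
    fix c c' assume "c \<in> P ` carrier_vec k" "c' \<in> P ` carrier_vec k" "c \<noteq> c'"
    then obtain x y where xy: "x \<in> carrier_vec k" "y \<in> carrier_vec k" "c = P x" "c' = P y" "P x \<noteq> P y"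
      by blast
    have P_iff: "P x $ j = P y $ j \<longleftrightarrow> (x - y) \<bullet> g (i * s + j) = 0" if "j < s" for j
      using that xy(1,2) col_carrier[of "i * s + j"] by (simp add: P_def minus_scalar_prod_distrib)
    obtain j0 where j0: "j0 < s" "(x - y) \<bullet> g (i * s + j0) \<noteq> 0"
    proof -
      have "\<exists>j<s. P x $ j \<noteq> P y $ j"
      proof (rule ccontr)
        assume "\<not> ?thesis"
        then have "P x = P y" by (intro eq_vecI) (simp_all add: P_def)
        then show False using xy(5) by simp
      qed
      then show ?thesis using P_iff that by blast
    qed
    let ?Z = "{j. j < s \<and> (x - y) \<bullet> g (i * s + j) = 0}"
    let ?N = "{j. j < s \<and> (x - y) \<bullet> g (i * s + j) \<noteq> 0}"
    have divi: "(i * s + j) div s = i" if "j < s" for j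
      using that by simp
    \<comment> \<open>Shifting by \<open>i * s\<close> turns positions within the block into global
      coordinates, where \<open>few_zeros_in_block\<close> applies with the nonzero position given
      by \<open>j0\<close>.\<close>
    have "card ((+) (i * s) ` ?Z) \<le>
        card {j. j < m * s \<and> j div s = (i * s + j0) div s \<and> (x - y) \<bullet> g j = 0}"
      using bound divi j0(1) by (intro card_mono) auto
    also have "\<dots> < r"
      using few_zeros_in_block[OF _ bound[OF j0(1)] j0(2)] xy(1,2) by simp
    finally have "card ?Z < r" by (simp add: card_image)
    moreover have "card (?N \<union> ?Z) = card ?N + card ?Z"
      by (rule card_Un_disjoint) auto
    moreover have "?N \<union> ?Z = {..<s}" by auto
    moreover have "hamming_distance c c' = card ?N"
      unfolding hamming_distance_def xy(3,4)
      using P_iff by (intro arg_cong[of _ _ card]) (auto simp: P_def)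
    ultimately show "Suc (s - r) \<le> hamming_distance c c'" using r_le_s by simp
  qed
  ultimately show ?thesis by simp
qed

text \<open>The blocks serve as the locality sets. They cover every coordinate, so the rank
  condition concerns \<open>gen\<close> itself.\<close>

lemma all_symbol_locality_code:
  assumes "r + \<delta> - 1 = s" "1 \<le> \<delta>"
  shows "all_symbol_locality (m * s) k r \<delta> code"
proof -
  define S where "S i = {i * s..<i * s + s}" for i
  have delta: "\<delta> = Suc (s - r)" using assms by simp
  have sub: "S i \<subseteq> {..<m * s}" if "i < m" for i
  proof -
    have "i * s + s \<le> m * s" using mult_le_mono1[of "Suc i" m s] that by simp
    then show ?thesis by (auto simp: S_def)
  qed
  have "l \<in> S (l div s)" for l
  proof -
    have "l div s * s + l mod s = l" by simp
    then show ?thesis using mod_less_divisor[OF s_pos, of l] unfolding S_def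
      by (metis atLeastLessThan_iff le_add1 nat_add_left_cancel_less)
  qed
  then have "{..<m * s} \<subseteq> (\<Union>i<m. S i)"
    using less_mult_imp_div_less by blast
  then have union: "\<Union>(S ` {..<m}) = {..<m * s}" using sub by blast
  have "locality_family (m * s) k r \<delta> code (S ` {..<m})"
    unfolding locality_family_def union
  proof (intro conjI ballI)
    fix B assume "B \<in> S ` {..<m}"
    then obtain i where i: "i < m" "B = S i" by blast
    show "B \<subseteq> {..<m * s}" using sub i by simp
    show "card B \<le> r + \<delta> - 1" using i assms by (simp add: S_def)
    show "\<delta> \<le> min_distance (puncture B code)"
      using puncture_block_distance[OF i(1)] i(2) delta by (simp add: S_def)
  next
    show "\<exists>G. generator_matrix (m * s) k code G \<and>
        vec_space.rank k (submatrix G UNIV {..<m * s}) = k"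
      using generator_matrix_gen rank_gen submatrix_UNIV_lessThan_dim_col[OF gen_carrier] by metis
  qed
  then show ?thesis unfolding all_symbol_locality_def using union by blast
qed

end

section \<open>Choice of parameters and optimality\<close>

theorem mainTheorem4:
  fixes q n k r \<delta> :: nat
  assumes "CARD('a::{field,finite}) = q"
    and "k \<ge> 1" and "r \<ge> 1" and "\<delta> \<ge> 2"
    and "distance_bound n k r \<delta> \<ge> 1"
    and "q > k * n ^ k"
    and "(r + \<delta> - 1) dvd n"
  shows "\<exists>(C :: 'a vec set) d. optimal_code n k d r \<delta> C"
proof -
  define s where "s = r + \<delta> - 1"
  \<comment> \<open>This is \<open>\<lceil>k/r\<rceil> - 1\<close>, as the ceiling computation below
    confirms.\<close>
  define p where "p = (k - 1) div r"
  obtain m where n: "n = m * s" using assms(7) unfolding s_def by (metis dvd_def mult.commute)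
  have s: "r \<le> s" "s - r = \<delta> - 1" using assms(4) by (auto simp: s_def)
  have "p * r + (k - 1) mod r = k - 1" by (simp add: p_def)
  moreover have "(k - 1) mod r < r" using assms(3) by simp
  ultimately have pk: "p * r < k" "k \<le> Suc p * r" using assms(2) unfolding mult_Suc by linarith+
  have ceil: "\<lceil>real k / real r\<rceil> = int p + 1"
  proof (rule ceiling_unique)
    have "real p * real r < real k" "real k \<le> (real p + 1) * real r"
      using pk by (simp_all flip: of_nat_mult of_nat_Suc of_nat_add add: algebra_simps)
    then show "real_of_int (int p + 1) - 1 < real k / real r" "real k / real r \<le> real_of_int (int p + 1)"
      using assms(3) by (simp_all add: field_simps)
  qed
  have bound: "distance_bound n k r \<delta> = int (Suc n) - int (k + p * (s - r))"
    unfolding distance_bound_def ceil s(2) using assms(4) by (simp add: of_nat_diff)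
  then have kn: "k + p * (s - r) \<le> n" using assms(5) by linarith
  \<comment> \<open>Otherwise \<open>n \<le> p * s = p * r + p * (s - r) < k + p * (s - r)\<close>,
    against the positivity of the distance bound.\<close>
  have "p < m"
  proof (rule ccontr)
    assume "\<not> p < m"
    then have "n \<le> p * s" unfolding n by (intro mult_le_mono1) simp
    moreover have "p * s = p * r + p * (s - r)" using s(1) by (simp flip: distrib_left)
    ultimately show False using pk(1) kn by linarith
  qed
  have "n ^ (k - 1) \<le> n ^ k" using kn assms(2) by (intro power_increasing) auto
  also have "\<dots> \<le> k * n ^ k" using assms(2) by simp
  finally have "n ^ (k - 1) < CARD('a)" using assms(1,6) by simp
  from exists_columns[OF this assms(2) s(1) order.refl]
  obtain g :: "nat \<Rightarrow> 'a vec" where g: "\<forall>j. g j \<in> carrier_vec k"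
    "\<forall>T \<subseteq> {..<n}. admissible k r s T \<longrightarrow> col_independent k g T"
    "\<forall>j < n. r \<le> j mod s \<longrightarrow> (\<forall>x \<in> annih k g (block_base r s j). x \<bullet> g j = 0)"
    by (elim exE conjE)
  interpret lrc_columns k r s m p g
    by unfold_locales (use g n s pk \<open>p < m\<close> assms(3) in auto)
  have "linear_code n k (min_distance code) code"
    unfolding linear_code_def n using subspace_code dim_code by simp
  moreover have "all_symbol_locality n k r \<delta> code"
    unfolding n by (rule all_symbol_locality_code) (use assms(4) in \<open>auto simp: s_def\<close>)
  moreover have "int (min_distance code) = distance_bound n k r \<delta>"
    using min_distance_code bound unfolding n by linarith
  ultimately show ?thesis unfolding optimal_code_def by blast
qed

end
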